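(* Let $G=(V,E)$ be a finite simple connected graph. Then $\beth^{2}(K^{\chi(G)})\le \beth^{2}(G)$; that is, $$\binom{\chi(G)}{3}-\binom{\chi(G)}{2}+\binom{\chi(G)}{1}\le \beth^{2}(G).$$
   Context: All graphs are finite and simple. $K^{t}$ is the complete graph on $t$ vertices and $\chi(G)$ is the chromatic number of $G$. $C(G)$ denotes the set of all induced cycles in $G$ (induced subgraphs of $G$ that are cycles, of length at least 3). The second graph characteristic is $\beth^{2}(G)=|C(G)|-|E(G)|+|V(G)|$. *)

theory Defs
  imports Complex_Main
begin

text \<open>
  A graph is a pair (vertex set, edge set); an edge is its two-element set of end vertices.
\<close>

type_synonym 'a graph = "'a set \<times> 'a set set"

abbreviation vertices :: "'a graph \<Rightarrow> 'a set" where
  "vertices G \<equiv> fst G"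

abbreviation edges :: "'a graph \<Rightarrow> 'a set set" where
  "edges G \<equiv> snd G"

definition finite_simple_graph :: "'a graph \<Rightarrow> bool" where
  "finite_simple_graph G \<longleftrightarrow>
     finite (vertices G) \<and> (\<forall>e\<in>edges G. e \<subseteq> vertices G \<and> card e = 2)"

text \<open>Under this definition the graph without vertices counts as connected.\<close>

definition connected_graph :: "'a graph \<Rightarrow> bool" where
  "connected_graph G \<longleftrightarrow>
     (\<forall>u\<in>vertices G. \<forall>v\<in>vertices G. (u, v) \<in> {(x, y). {x, y} \<in> edges G}\<^sup>*)"

definition complete_graph :: "nat \<Rightarrow> nat graph" where
  "complete_graph t = ({..<t}, {e. e \<subseteq> {..<t} \<and> card e = 2})"

definition proper_coloring :: "'a graph \<Rightarrow> nat \<Rightarrow> ('a \<Rightarrow> nat) \<Rightarrow> bool" where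
  "proper_coloring G k c \<longleftrightarrow>
     (\<forall>v\<in>vertices G. c v < k) \<and> (\<forall>u v. {u, v} \<in> edges G \<longrightarrow> c u \<noteq> c v)"

definition chromatic_number :: "'a graph \<Rightarrow> nat" where
  "chromatic_number G = (LEAST k. \<exists>c. proper_coloring G k c)"

definition induced_subgraph :: "'a graph \<Rightarrow> 'a set \<Rightarrow> 'a graph" where
  "induced_subgraph G W = (W, {e \<in> edges G. e \<subseteq> W})"

definition is_cycle :: "'a graph \<Rightarrow> bool" where
  "is_cycle H \<longleftrightarrow>
     (\<exists>vs. distinct vs \<and> 3 \<le> length vs \<and> vertices H = set vs \<and>
           edges H = {{vs ! i, vs ! (Suc i mod length vs)} | i. i < length vs})"

definition induced_cycles :: "'a graph \<Rightarrow> 'a graph set" where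
  "induced_cycles G = {H. (\<exists>W\<subseteq>vertices G. H = induced_subgraph G W) \<and> is_cycle H}"

definition beth2 :: "'a graph \<Rightarrow> int" where
  "beth2 G = int (card (induced_cycles G)) - int (card (edges G)) + int (card (vertices G))"

end

theory Submission
  imports Defs
begin

text \<open>
  The bound is \<open>\<beth>\<^sup>2(G) \<ge> C(k, 3) + 1\<close> whenever \<open>G\<close> is not \<open>k\<close>-colourable, by induction on
  the number of vertices. Contracting an edge does not increase \<open>\<beth>\<^sup>2\<close>: induced cycles
  of the contraction lift injectively, and the triangles on the edge, which are not lifts, make up
  for the merged edges. For \<open>k \<le> 2\<close> contract any edge. For \<open>k \<ge> 3\<close> take a vertex \<open>v\<close> of degree
  \<open>d > 0\<close>; if contracting some edge \<open>vs\<close> preserves non-\<open>k\<close>-colourability, contract it.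
  Otherwise each neighbour \<open>s\<close> of \<open>v\<close> is the only neighbour of its colour in some
  \<open>k\<close>-colouring of \<open>G - v\<close>, and Kempe chains from \<open>s\<close> into each of the other \<open>k - 1\<close> colours
  give induced cycles through \<open>v\<close> whose other neighbours of \<open>v\<close> are distinct. So \<open>d \<ge> k\<close>, and at
  least \<open>d (k - 1) / 2\<close> induced cycles pass through \<open>v\<close>; hence deleting \<open>v\<close> lowers \<open>\<beth>\<^sup>2\<close> by
  at least \<open>d (k - 1) / 2 - d + 1 \<ge> C(k - 1, 2)\<close>.
\<close>

subsection \<open>Induced paths and induced cycles as lists\<close>

text \<open>Each vertex is tested only against later ones, so for symmetric \<open>A\<close> this is
  the usual induced path. The recursive form suits paths that grow by prepending a vertex.\<close>

primrec induced_path :: "('a \<Rightarrow> 'a \<Rightarrow> bool) \<Rightarrow> 'a list \<Rightarrow> bool" where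
  "induced_path A [] \<longleftrightarrow> True"
| "induced_path A (x # p) \<longleftrightarrow>
     x \<notin> set p \<and> (p = [] \<or> {z \<in> set p. A x z} = {hd p}) \<and> induced_path A p"

text \<open>An induced cycle opened at \<open>x\<close>. The length bound keeps the two ends of
  \<open>p\<close> apart, so the cycle has at least three vertices.\<close>

definition cycle_through :: "('a \<Rightarrow> 'a \<Rightarrow> bool) \<Rightarrow> 'a \<Rightarrow> 'a list \<Rightarrow> bool" where
  "cycle_through A x p \<longleftrightarrow>
     x \<notin> set p \<and> induced_path A p \<and> 2 \<le> length p \<and> {z \<in> set p. A x z} = {hd p, last p}"

definition cyclic_list :: "('a \<Rightarrow> 'a \<Rightarrow> bool) \<Rightarrow> 'a list \<Rightarrow> bool" where
  "cyclic_list A vs \<longleftrightarrow> distinct vs \<and> 3 \<le> length vs \<and>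
     (\<forall>i<length vs. \<forall>j<length vs. A (vs ! i) (vs ! j) \<longleftrightarrow>
        j = Suc i mod length vs \<or> i = Suc j mod length vs)"

text \<open>An induced cycle is determined by its vertex set; counting sets avoids counting the
  rotations and reflections of one cycle separately.\<close>

definition cycle_set :: "('a \<Rightarrow> 'a \<Rightarrow> bool) \<Rightarrow> 'a set \<Rightarrow> bool" where
  "cycle_set A W \<longleftrightarrow> (\<exists>vs. set vs = W \<and> cyclic_list A vs)"

lemma induced_path_cong:
  assumes "\<And>y z. y \<in> set p \<Longrightarrow> z \<in> set p \<Longrightarrow> A y z = B y z"
  shows "induced_path A p = induced_path B p"
  using assms
proof (induction p)
  case (Cons x p)
  have "{z \<in> set p. A x z} = {z \<in> set p. B x z}"
    using Cons.prems by auto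
  moreover have "induced_path A p = induced_path B p"
    using Cons.prems by (intro Cons.IH) auto
  ultimately show ?case by simp
qed simp

lemma cycle_set_cong:
  assumes "\<And>y z. y \<in> W \<Longrightarrow> z \<in> W \<Longrightarrow> A y z = B y z"
  shows "cycle_set A W = cycle_set B W"
proof -
  have "cyclic_list A vs = cyclic_list B vs" if "set vs = W" for vs
    using that assms unfolding cyclic_list_def by (metis nth_mem)
  then show ?thesis unfolding cycle_set_def by blast
qed

lemma induced_path_distinct: "induced_path A p \<Longrightarrow> distinct p"
  by (induction p) auto

lemma induced_path_appendD: "induced_path A (p @ q) \<Longrightarrow> induced_path A q"
  by (induction p) auto

lemma induced_path_nth:
  "induced_path A p \<longleftrightarrow>
     distinct p \<and> (\<forall>i j. i < j \<longrightarrow> j < length p \<longrightarrow> (A (p ! i) (p ! j) \<longleftrightarrow> j = Suc i))"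
proof (induction p)
  case (Cons x p)
  have "(p = [] \<or> {z \<in> set p. A x z} = {hd p}) \<longleftrightarrow> (\<forall>j<length p. A x (p ! j) \<longleftrightarrow> j = 0)"
    if "distinct p"
  proof (cases p)
    case (Cons y q)
    have "{z \<in> set p. A x z} = {hd p} \<longleftrightarrow> (\<forall>z\<in>set p. A x z \<longleftrightarrow> z = p ! 0)"
      using Cons by auto
    also have "\<dots> \<longleftrightarrow> (\<forall>j<length p. A x (p ! j) \<longleftrightarrow> p ! j = p ! 0)"
      by (metis in_set_conv_nth)
    also have "\<dots> \<longleftrightarrow> (\<forall>j<length p. A x (p ! j) \<longleftrightarrow> j = 0)"
      using that Cons by (metis length_greater_0_conv list.discI nth_eq_iff_index_eq)
    finally show ?thesis using Cons by simp
  qed simp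
  moreover have "(\<forall>i j. i < j \<longrightarrow> j < length (x # p) \<longrightarrow>
        (A ((x # p) ! i) ((x # p) ! j) \<longleftrightarrow> j = Suc i)) \<longleftrightarrow>
      (\<forall>j<length p. A x (p ! j) \<longleftrightarrow> j = 0) \<and>
      (\<forall>i j. i < j \<longrightarrow> j < length p \<longrightarrow> (A (p ! i) (p ! j) \<longleftrightarrow> j = Suc i))" (is "?L = ?R")
  proof
    assume L: ?L
    have "A x (p ! j) \<longleftrightarrow> j = 0" if "j < length p" for j
      using L[rule_format, of 0 "Suc j"] that by simp
    moreover have "A (p ! i) (p ! j) \<longleftrightarrow> j = Suc i" if "i < j" "j < length p" for i j
      using L[rule_format, of "Suc i" "Suc j"] that by simp
    ultimately show ?R by blast
  next
    assume ?R
    then show ?L by (auto simp: nth_Cons split: nat.splits)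
  qed
  ultimately show ?case using Cons.IH by auto
qed simp

text \<open>With \<open>x\<close> at index 0, indices \<open>i < j\<close> are cyclically
  consecutive iff \<open>j = Suc i\<close> or they are the first and the last. Pairs with
  \<open>i = 0\<close> describe the neighbours of \<open>x\<close>, the others the path; symmetry
  and irreflexivity settle \<open>j \<le> i\<close>.\<close>

lemma cyclic_list_Cons:
  assumes "symp A" "irreflp A"
  shows "cyclic_list A (x # p) \<longleftrightarrow> cycle_through A x p"
proof (cases "distinct (x # p) \<and> 2 \<le> length p")
  case True
  define n where "n = length (x # p)"
  have n: "3 \<le> n" "length p = n - 1" using True by (auto simp: n_def)
  have wrap: "(j = Suc i mod n \<or> i = Suc j mod n) \<longleftrightarrow> (j = Suc i \<or> i = 0 \<and> j = n - 1)"
    if "i < j" "j < n" for i j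
    using that n by (cases "Suc j = n") auto
  have self: "i \<noteq> Suc i mod n" if "i < n" for i
    using that n by (cases "Suc i = n") auto
  have "cyclic_list A (x # p) \<longleftrightarrow> (\<forall>i j. i < j \<longrightarrow> j < n \<longrightarrow>
      (A ((x # p) ! i) ((x # p) ! j) \<longleftrightarrow> j = Suc i \<or> i = 0 \<and> j = n - 1))" (is "_ = ?M")
  proof
    assume "cyclic_list A (x # p)"
    then have *: "A ((x # p) ! i) ((x # p) ! j) \<longleftrightarrow> j = Suc i mod n \<or> i = Suc j mod n"
      if "i < n" "j < n" for i j
      using that unfolding cyclic_list_def n_def by blast
    show ?M
    proof (intro allI impI)
      fix i j assume "i < j" "j < n"
      then show "A ((x # p) ! i) ((x # p) ! j) \<longleftrightarrow> j = Suc i \<or> i = 0 \<and> j = n - 1"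
        using *[of i j] wrap[of i j] by linarith
    qed
  next
    assume M: ?M
    have "A ((x # p) ! i) ((x # p) ! j) \<longleftrightarrow> j = Suc i mod n \<or> i = Suc j mod n"
      if "i < n" "j < n" for i j
    proof (cases i j rule: linorder_cases)
      case less
      then show ?thesis using M[rule_format, of i j] wrap[of i j] that by blast
    next
      case equal
      then show ?thesis using self[of i] that irreflpD[OF assms(2), of "(x # p) ! i"] by simp
    next
      case greater
      moreover have "A ((x # p) ! i) ((x # p) ! j) \<longleftrightarrow> A ((x # p) ! j) ((x # p) ! i)"
        using sympD[OF assms(1)] by blast
      ultimately show ?thesis using M[rule_format, of j i] wrap[of j i] that by blast
    qed
    then show "cyclic_list A (x # p)"
      using True unfolding cyclic_list_def n_def by auto
  qed
  also have "\<dots> \<longleftrightarrow> (\<forall>j<length p. A x (p ! j) \<longleftrightarrow> j = 0 \<or> j = length p - 1) \<and>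
      (\<forall>i j. i < j \<longrightarrow> j < length p \<longrightarrow> (A (p ! i) (p ! j) \<longleftrightarrow> j = Suc i))" (is "?L = ?R")
  proof
    assume L: ?L
    have "A x (p ! j) \<longleftrightarrow> j = 0 \<or> j = length p - 1" if "j < length p" for j
      using L[rule_format, of 0 "Suc j"] that n by auto
    moreover have "A (p ! i) (p ! j) \<longleftrightarrow> j = Suc i" if "i < j" "j < length p" for i j
      using L[rule_format, of "Suc i" "Suc j"] that n by simp
    ultimately show ?R by blast
  next
    assume R: ?R
    show ?L
    proof (intro allI impI)
      fix i j assume "i < j" "j < n"
      then show "A ((x # p) ! i) ((x # p) ! j) \<longleftrightarrow> j = Suc i \<or> i = 0 \<and> j = n - 1"
        using R n by (cases i; cases j) auto
    qed
  qed
  also have "(\<forall>j<length p. A x (p ! j) \<longleftrightarrow> j = 0 \<or> j = length p - 1) \<longleftrightarrow>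
      {z \<in> set p. A x z} = {hd p, last p}"
  proof -
    have ne: "p \<noteq> []" using True by auto
    have "{z \<in> set p. A x z} = {hd p, last p} \<longleftrightarrow>
        (\<forall>z\<in>set p. A x z \<longleftrightarrow> z = hd p \<or> z = last p)"
      using ne by auto
    also have "\<dots> \<longleftrightarrow> (\<forall>j<length p. A x (p ! j) \<longleftrightarrow> p ! j = hd p \<or> p ! j = last p)"
      by (metis in_set_conv_nth)
    also have "\<dots> \<longleftrightarrow> (\<forall>j<length p. A x (p ! j) \<longleftrightarrow> j = 0 \<or> j = length p - 1)"
    proof -
      have "p ! j = hd p \<longleftrightarrow> j = 0" "p ! j = last p \<longleftrightarrow> j = length p - 1"
        if "j < length p" for j
        using that True ne by (auto simp: hd_conv_nth last_conv_nth nth_eq_iff_index_eq)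
      then show ?thesis by blast
    qed
    finally show ?thesis by blast
  qed
  finally show ?thesis
    using True unfolding cycle_through_def induced_path_nth by auto
next
  case False
  then show ?thesis
    unfolding cyclic_list_def cycle_through_def
    using induced_path_distinct[of A p] by auto
qed

lemma cyclic_list_rotate:
  assumes "cyclic_list A vs"
  shows "cyclic_list A (rotate m vs)"
proof -
  define n where "n = length vs"
  have n: "0 < n" using assms by (auto simp: cyclic_list_def n_def)
  have inj: "(m + i) mod n = (m + j) mod n \<longleftrightarrow> i = j" if "i < n" "j < n" for i j
  proof -
    have "distinct (rotate m vs)" using assms by (simp add: cyclic_list_def)
    then have "rotate m vs ! i = rotate m vs ! j \<longleftrightarrow> i = j"
      using that by (simp add: n_def nth_eq_iff_index_eq)
    then show ?thesis using that by (auto simp: nth_rotate n_def)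
  qed
  have "A (rotate m vs ! i) (rotate m vs ! j) \<longleftrightarrow> j = Suc i mod n \<or> i = Suc j mod n"
    if ij: "i < n" "j < n" for i j
  proof -
    have suc: "Suc ((m + k) mod n) mod n = (m + Suc k mod n) mod n" for k
      by (simp add: mod_Suc_eq mod_add_right_eq)
    have "A (rotate m vs ! i) (rotate m vs ! j) \<longleftrightarrow>
        (m + j) mod n = Suc ((m + i) mod n) mod n \<or> (m + i) mod n = Suc ((m + j) mod n) mod n"
      using assms ij n unfolding cyclic_list_def by (simp add: nth_rotate n_def)
    then show ?thesis
      unfolding suc using inj ij n by simp
  qed
  then show ?thesis using assms by (simp add: cyclic_list_def n_def)
qed

text \<open>Rotating the list brings any chosen vertex to the front, so a cycle can be opened at the
  vertex where the graph is about to change.\<close>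

lemma cycle_set_iff:
  assumes "symp A" "irreflp A" "x \<in> W"
  shows "cycle_set A W \<longleftrightarrow> (\<exists>p. W = insert x (set p) \<and> cycle_through A x p)"
proof
  assume "cycle_set A W"
  then obtain vs where vs: "set vs = W" "cyclic_list A vs" by (auto simp: cycle_set_def)
  then obtain ys zs where "vs = ys @ x # zs" using assms(3) by (meson split_list)
  then have rot: "rotate (length ys) vs = x # zs @ ys" by (simp add: rotate_append)
  then have "cycle_through A x (zs @ ys)"
    using cyclic_list_rotate[OF vs(2), of "length ys"] cyclic_list_Cons[OF assms(1,2)] by simp
  moreover have "W = insert x (set (zs @ ys))"
    using vs(1) rot by (metis list.simps(15) set_rotate)
  ultimately show "\<exists>p. W = insert x (set p) \<and> cycle_through A x p" by blast
next
  assume "\<exists>p. W = insert x (set p) \<and> cycle_through A x p"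
  then show "cycle_set A W"
    using cyclic_list_Cons[OF assms(1,2)] unfolding cycle_set_def by (metis list.simps(15))
qed

text \<open>A walk is shortened to an induced path, starting from its end. A vertex \<open>x\<close>
  in front of \<open>p\<close> either lies on \<open>p\<close>, or is in \<open>T\<close> and forms
  a path alone, or is prepended to a suffix of \<open>p\<close>. Suffixes keep the last vertex,
  hence the only one in \<open>T\<close>.\<close>

lemma obtain_induced_path:
  assumes "(x, y) \<in> {(a, b). a \<in> B \<and> b \<in> B \<and> A a b}\<^sup>*" "x \<in> B" "y \<in> T"
  shows "\<exists>p. p \<noteq> [] \<and> induced_path A p \<and> hd p = x \<and> set p \<subseteq> B \<and> set p \<inter> T = {last p}"
  using assms
proof (induction rule: converse_rtrancl_induct)
  case base
  then show ?case by (intro exI[of _ "[y]"]) auto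
next
  case (step x x')
  then obtain p where p: "p \<noteq> []" "induced_path A p" "hd p = x'" "set p \<subseteq> B"
    "set p \<inter> T = {last p}" by auto
  show ?case
  proof (cases "x \<in> set p")
    case True
    then obtain q r where pq: "p = q @ x # r" by (meson split_list)
    then have "set (x # r) \<inter> T = {last (x # r)}"
      using p(5) by (auto split: if_splits)
    moreover have "induced_path A (x # r)"
      using p(2) induced_path_appendD unfolding pq by blast
    ultimately show ?thesis using p(4) pq by (intro exI[of _ "x # r"]) auto
  next
    case False
    show ?thesis
    proof (cases "x \<in> T")
      case True
      then show ?thesis using step.prems by (intro exI[of _ "[x]"]) auto
    next
      case nT: False
      \<comment> \<open>Cutting \<open>p\<close> at the last neighbour \<open>z\<close> of
        \<open>x\<close> leaves \<open>z\<close> as the only neighbour of \<open>x\<close> on the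
        suffix.\<close>
      have "\<exists>z\<in>set p. A x z" using p(1,3) step.hyps(1) by auto
      then obtain q z r where pq: "p = q @ z # r" "A x z" "\<forall>w\<in>set r. \<not> A x w"
        using split_list_last_prop[of p "A x"] by blast
      have "set (z # r) \<inter> T = {last (z # r)}"
        using p(5) unfolding pq by (auto split: if_splits)
      then have "set (x # z # r) \<inter> T = {last (x # z # r)}"
        using nT by auto
      moreover have "induced_path A (z # r)"
        using p(2) induced_path_appendD unfolding pq by blast
      then have "induced_path A (x # z # r)"
        using pq False by auto
      ultimately show ?thesis
        using p(4) pq step.prems by (intro exI[of _ "x # z # r"]) auto
    qed
  qed
qed


subsection \<open>Deletion and contraction\<close>

definition cycles :: "'a set \<Rightarrow> ('a \<Rightarrow> 'a \<Rightarrow> bool) \<Rightarrow> 'a set set" where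
  "cycles V A = {W. W \<subseteq> V \<and> cycle_set A W}"

definition edge_set :: "'a set \<Rightarrow> ('a \<Rightarrow> 'a \<Rightarrow> bool) \<Rightarrow> 'a set set" where
  "edge_set V A = {{a, b} | a b. a \<in> V \<and> b \<in> V \<and> A a b}"

definition nbrs :: "'a set \<Rightarrow> ('a \<Rightarrow> 'a \<Rightarrow> bool) \<Rightarrow> 'a \<Rightarrow> 'a set" where
  "nbrs V A v = {w \<in> V. A v w}"

text \<open>The counterpart of \<open>beth2\<close> with vertex set and adjacency kept apart:
  deleting a vertex shrinks \<open>V\<close> and leaves \<open>A\<close> alone.\<close>

definition beth :: "'a set \<Rightarrow> ('a \<Rightarrow> 'a \<Rightarrow> bool) \<Rightarrow> int" where
  "beth V A = int (card (cycles V A)) - int (card (edge_set V A)) + int (card V)"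

text \<open>The edge \<open>u v\<close> is contracted onto \<open>u\<close>; \<open>v\<close> is meant to be removed from the vertex set.\<close>

definition contract :: "('a \<Rightarrow> 'a \<Rightarrow> bool) \<Rightarrow> 'a \<Rightarrow> 'a \<Rightarrow> 'a \<Rightarrow> 'a \<Rightarrow> bool" where
  "contract A u v y z \<longleftrightarrow> y \<noteq> z \<and> (A y z \<or> y = u \<and> A v z \<or> z = u \<and> A y v)"

definition colorable :: "'a set \<Rightarrow> ('a \<Rightarrow> 'a \<Rightarrow> bool) \<Rightarrow> nat \<Rightarrow> bool" where
  "colorable V A k \<longleftrightarrow>
     (\<exists>c. (\<forall>v\<in>V. c v < k) \<and> (\<forall>u\<in>V. \<forall>v\<in>V. A u v \<longrightarrow> c u \<noteq> c v))"

lemma finite_cycles: "finite V \<Longrightarrow> finite (cycles V A)"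
  unfolding cycles_def by (rule finite_subset[of _ "Pow V"]) auto

lemma finite_edge_set: "finite V \<Longrightarrow> finite (edge_set V A)"
  unfolding edge_set_def by (rule finite_subset[of _ "Pow V"]) auto

lemma symp_contract: "symp A \<Longrightarrow> symp (contract A u v)"
  by (auto simp: symp_def contract_def)

lemma irreflp_contract: "irreflp (contract A u v)"
  by (auto simp: irreflp_def contract_def)

lemma card_edge_set_remove:
  assumes "finite V" "symp A" "irreflp A" "v \<in> V"
  shows "card (edge_set V A) = card (edge_set (V - {v}) A) + card (nbrs V A v)"
proof -
  have nv: "\<not> A v v" using assms(3) by (simp add: irreflpD)
  have sym: "A a b \<Longrightarrow> A b a" for a b using assms(2) by (rule sympD)
  have "edge_set V A = edge_set (V - {v}) A \<union> (\<lambda>w. {v, w}) ` nbrs V A v" (is "_ = ?L \<union> ?R")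
  proof
    show "edge_set V A \<subseteq> ?L \<union> ?R"
    proof
      fix e assume "e \<in> edge_set V A"
      then obtain a b where e: "e = {a, b}" "a \<in> V" "b \<in> V" "A a b"
        by (auto simp: edge_set_def)
      consider "a = v" | "b = v" | "a \<noteq> v" "b \<noteq> v" by blast
      then show "e \<in> ?L \<union> ?R"
      proof cases
        case 1
        then show ?thesis using e by (auto simp: nbrs_def)
      next
        case 2
        then have "e = {v, a}" "a \<in> nbrs V A v" using e sym by (auto simp: nbrs_def)
        then show ?thesis by blast
      next
        case 3
        then show ?thesis using e by (auto simp: edge_set_def)
      qed
    qed
    show "?L \<union> ?R \<subseteq> edge_set V A"
      using assms(4) by (auto simp: edge_set_def nbrs_def)
  qed
  moreover have "?L \<inter> ?R = {}"
  proof -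
    have "v \<notin> e" if "e \<in> ?L" for e using that by (auto simp: edge_set_def)
    then show ?thesis by blast
  qed
  moreover have "card ?R = card (nbrs V A v)"
    by (rule card_image) (auto simp: inj_on_def doubleton_eq_iff)
  moreover have "finite ?R" using assms(1) by (simp add: nbrs_def)
  ultimately show ?thesis
    using card_Un_disjoint[of ?L ?R] finite_edge_set[of "V - {v}" A] assms(1) by simp
qed

lemma beth_remove:
  assumes "finite V" "symp A" "irreflp A" "v \<in> V"
  shows "beth V A = beth (V - {v}) A + int (card {W \<in> cycles V A. v \<in> W})
           - int (card (nbrs V A v)) + 1"
proof -
  have "cycles V A = cycles (V - {v}) A \<union> {W \<in> cycles V A. v \<in> W}"
    by (auto simp: cycles_def)
  moreover have "cycles (V - {v}) A \<inter> {W \<in> cycles V A. v \<in> W} = {}"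
    by (auto simp: cycles_def)
  ultimately have "card (cycles V A) =
      card (cycles (V - {v}) A) + card {W \<in> cycles V A. v \<in> W}"
    using card_Un_disjoint finite_cycles[of "V - {v}" A] finite_cycles[of V A] assms(1)
    by (metis (no_types, lifting) finite_Diff finite_Un)
  moreover have "card V = Suc (card (V - {v}))"
    using assms(1,4) by (rule card.remove)
  ultimately show ?thesis
    using card_edge_set_remove[OF assms] by (simp add: beth_def)
qed

text \<open>Opened at \<open>u\<close>, the cycle leaves an \<open>A\<close>-induced path, and
  exactly its two ends are adjacent to \<open>u\<close> or \<open>v\<close>. The clauses on
  \<open>X\<close> serve the count in \<open>beth_contract\<close>: the first ones recover
  \<open>W\<close> from \<open>X\<close>, the last one separates \<open>X\<close> from the triangles
  on the edge \<open>u v\<close>.\<close>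

lemma contract_cycle_lift:
  assumes "symp A" "irreflp A" "A u v" "W \<subseteq> V - {v}" "cycle_set (contract A u v) W" "u \<in> W"
  shows "\<exists>X. cycle_set A X \<and> X - {u, v} = W - {u} \<and> X \<inter> {u, v} \<noteq> {} \<and> X \<subseteq> W \<union> {v} \<and>
           (\<forall>t. X \<noteq> {u, v, t})"
proof -
  let ?B = "contract A u v"
  obtain p where W: "W = insert u (set p)" and p: "cycle_through ?B u p"
    using cycle_set_iff[OF symp_contract[OF assms(1)] irreflp_contract assms(6)] assms(5) by blast
  have up: "u \<notin> set p" and vp: "v \<notin> set p" using p assms(4) W by (auto simp: cycle_through_def)
  have len: "2 \<le> length p" using p by (simp add: cycle_through_def)
  then have ne: "p \<noteq> []" by auto
  have path: "induced_path A p"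
  proof -
    have "induced_path ?B p" using p by (simp add: cycle_through_def)
    moreover have "induced_path ?B p = induced_path A p"
      using up irreflpD[OF assms(2)] by (intro induced_path_cong) (auto simp: contract_def)
    ultimately show ?thesis by simp
  qed
  have dist: "distinct p" using path by (rule induced_path_distinct)
  have hl: "hd p \<noteq> last p"
    using len dist ne by (simp add: hd_conv_nth last_conv_nth nth_eq_iff_index_eq)
  have ends: "A u z \<or> A v z \<longleftrightarrow> z = hd p \<or> z = last p" if "z \<in> set p" for z
  proof -
    have "?B u z \<longleftrightarrow> z \<in> {hd p, last p}"
      using p that unfolding cycle_through_def by blast
    moreover have "?B u z \<longleftrightarrow> A u z \<or> A v z" using that up by (auto simp: contract_def)
    ultimately show ?thesis by blast
  qed
  have nt: "set p \<noteq> {t}" for t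
    using hl ne by (metis hd_in_set last_in_set singletonD)
  have uv: "u \<noteq> v" using assms(2,3) by (metis irreflpD)
  \<comment> \<open>One of \<open>u\<close>, \<open>v\<close> sees both ends and closes the path
    alone.\<close>
  have direct: ?thesis if w: "w \<in> {u, v}" "A w (hd p)" "A w (last p)" for w
  proof -
    have "{z \<in> set p. A w z} = {hd p, last p}"
      using w ends ne by auto
    then have "cycle_through A w p"
      using w up vp len path by (auto simp: cycle_through_def)
    then have "cycle_set A (insert w (set p))"
      using cycle_set_iff[OF assms(1,2)] by blast
    moreover have "insert w (set p) \<noteq> {u, v, t}" for t
      using w(1) up vp uv by auto
    ultimately show ?thesis
      using W w(1) up vp by (intro exI[of _ "insert w (set p)"]) auto
  qed
  \<comment> \<open>Each of \<open>u\<close>, \<open>v\<close> sees a different end only, so the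
    contracted edge is put back and the cycle grows by one vertex.\<close>
  have mixed: ?thesis if w: "w \<in> {u, v}" "w' \<in> {u, v}" "A w w'" "A w (hd p)" "\<not> A w (last p)"
      "A w' (last p)" "\<not> A w' (hd p)" for w w'
  proof -
    have ww: "w \<noteq> w'" using w by blast
    have "{z \<in> set p. A w z} = {hd p}" "{z \<in> set p. A w' z} = {last p}"
      using w ends ne by auto
    moreover have "A w' w" using w(3) assms(1) by (simp add: sympD)
    ultimately have "cycle_through A w' (w # p)"
      using w(1,2) ww up vp len path ne by (auto simp: cycle_through_def)
    then have "cycle_set A (insert w' (set (w # p)))"
      using cycle_set_iff[OF assms(1,2)] by blast
    moreover have eq: "insert w' (set (w # p)) = {u, v} \<union> set p"
      using w(1,2) ww by auto
    moreover have "{u, v} \<union> set p \<noteq> {u, v, t}" for t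
    proof
      assume "{u, v} \<union> set p = {u, v, t}"
      then have "set p \<subseteq> {t}" using up vp by auto
      then show False using nt ne by (metis set_empty subset_singletonD)
    qed
    ultimately show ?thesis
      using W up vp by (intro exI[of _ "{u, v} \<union> set p"]) auto
  qed
  have "A v u" using assms(1,3) by (simp add: sympD)
  then show ?thesis
    using direct[of u] direct[of v] mixed[of u v] mixed[of v u] ends[of "hd p"] ends[of "last p"]
      ne assms(3) by auto
qed

lemma cycle_set_triangle:
  assumes "symp A" "irreflp A" "A u v" "A u t" "A v t"
  shows "cycle_set A {u, v, t}"
proof -
  have "v \<noteq> t" "u \<noteq> v" "u \<noteq> t" using assms by (auto simp: irreflp_def)
  then have "cycle_through A u [v, t]"
    using assms by (auto simp: cycle_through_def)
  then show ?thesis using cycle_set_iff[OF assms(1,2), of u "{u, v, t}"] by fastforce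
qed

text \<open>With \<open>T\<close> the common neighbours of \<open>u\<close> and \<open>v\<close>,
  contraction loses one vertex and \<open>card T + 1\<close> edges. It also loses at least
  \<open>card T\<close> cycles: the lifts are distinct cycles of \<open>A\<close>, and none is a
  triangle \<open>{u, v, t}\<close>.\<close>

lemma beth_contract:
  assumes "finite V" "symp A" "irreflp A" "u \<in> V" "v \<in> V" "A u v"
  shows "beth (V - {v}) (contract A u v) \<le> beth V A"
proof -
  let ?B = "contract A u v" and ?V = "V - {v}"
  define T where "T = {t \<in> V. A u t \<and> A v t}"
  have uv: "u \<noteq> v" "\<not> A u u" "\<not> A v v" using assms(3,6) by (auto simp: irreflp_def)
  have vu: "A v u" using assms(2,6) by (simp add: sympD)
  define lift where "lift W = (if u \<in> W then
    (SOME X. cycle_set A X \<and> X - {u, v} = W - {u} \<and> X \<inter> {u, v} \<noteq> {} \<and> X \<subseteq> W \<union> {v} \<and>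
           (\<forall>t. X \<noteq> {u, v, t})) else W)" for W
  have lift1: "cycle_set A (lift W) \<and> lift W - {u, v} = W - {u} \<and> lift W \<inter> {u, v} \<noteq> {} \<and>
      lift W \<subseteq> W \<union> {v} \<and> (\<forall>t. lift W \<noteq> {u, v, t})"
    if "W \<in> cycles ?V ?B" "u \<in> W" for W
  proof -
    have "W \<subseteq> V - {v}" "cycle_set ?B W" using that by (auto simp: cycles_def)
    from someI_ex[OF contract_cycle_lift[OF assms(2,3,6) this that(2)]]
    show ?thesis using that(2) unfolding lift_def by simp
  qed
  have lift2: "cycle_set A W" "u \<notin> W" "v \<notin> W" "lift W = W" if "W \<in> cycles ?V ?B" "u \<notin> W" for W
  proof -
    have "cycle_set ?B W = cycle_set A W"
      using that(2) uv assms(3) by (intro cycle_set_cong) (auto simp: contract_def irreflp_def)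
    then show "cycle_set A W" "u \<notin> W" "v \<notin> W" "lift W = W"
      using that by (auto simp: cycles_def lift_def)
  qed
  have inj: "inj_on lift (cycles ?V ?B)"
  proof (rule inj_onI)
    fix W X assume WX: "W \<in> cycles ?V ?B" "X \<in> cycles ?V ?B" "lift W = lift X"
    \<comment> \<open>The lift shows whether \<open>u\<close> was on the cycle, by meeting
      \<open>{u, v}\<close>, and it keeps all other vertices; this makes \<open>lift\<close>
      injective.\<close>
    have rec: "u \<in> Y \<longleftrightarrow> lift Y \<inter> {u, v} \<noteq> {}" "Y - {u} = lift Y - {u, v}"
      if "Y \<in> cycles ?V ?B" for Y
      using lift1[OF that] lift2[OF that] by (cases "u \<in> Y"; auto)+
    have "u \<in> W \<longleftrightarrow> u \<in> X" "W - {u} = X - {u}"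
      using rec[OF WX(1)] rec[OF WX(2)] WX(3) by auto
    then show "W = X" by blast
  qed
  have "lift ` cycles ?V ?B \<subseteq> cycles V A"
  proof
    fix X assume "X \<in> lift ` cycles ?V ?B"
    then obtain W where W: "W \<in> cycles ?V ?B" "X = lift W" by blast
    then have "W \<subseteq> V" by (auto simp: cycles_def)
    then show "X \<in> cycles V A"
      using W lift1[OF W(1)] lift2[OF W(1)] assms(5) by (cases "u \<in> W") (auto simp: cycles_def)
  qed
  moreover have "(\<lambda>t. {u, v, t}) ` T \<subseteq> cycles V A"
    using cycle_set_triangle[OF assms(2,3,6)] assms(4,5) by (auto simp: T_def cycles_def)
  moreover have "lift ` cycles ?V ?B \<inter> (\<lambda>t. {u, v, t}) ` T = {}"
  proof -
    have "lift W \<noteq> {u, v, t}" if "W \<in> cycles ?V ?B" for W t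
      using lift1[OF that] lift2[OF that] by (cases "u \<in> W") auto
    then show ?thesis by blast
  qed
  ultimately have "card (lift ` cycles ?V ?B) + card ((\<lambda>t. {u, v, t}) ` T) \<le> card (cycles V A)"
    using finite_cycles[OF assms(1)]
    by (metis Un_least card_Un_disjoint card_mono finite_subset)
  moreover have "card ((\<lambda>t. {u, v, t}) ` T) = card T"
  proof (rule card_image, rule inj_onI)
    fix s t assume st: "s \<in> T" "t \<in> T" "{u, v, s} = {u, v, t}"
    then have "s \<noteq> u" "s \<noteq> v" "t \<noteq> u" "t \<noteq> v" using uv by (auto simp: T_def)
    then show "s = t" using st(3) by blast
  qed
  ultimately have cyc: "card (cycles ?V ?B) + card T \<le> card (cycles V A)"
    using card_image[OF inj] by simp
  have fin: "finite ?V" "finite (nbrs ?V A u)" "finite (nbrs V A v - {u})"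
    using assms(1) by (auto simp: nbrs_def)
  have "card (edge_set V A) = card (edge_set (?V - {u}) A) + card (nbrs ?V A u) + card (nbrs V A v)"
    using card_edge_set_remove[OF assms(1-3,5)] card_edge_set_remove[OF fin(1) assms(2,3), of u]
      assms(4) uv by simp
  moreover have "card (edge_set ?V ?B) = card (edge_set (?V - {u}) ?B) + card (nbrs ?V ?B u)"
    using card_edge_set_remove[OF fin(1) symp_contract[OF assms(2)] irreflp_contract, of u]
      assms(4) uv by simp
  moreover have "edge_set (?V - {u}) ?B = edge_set (?V - {u}) A"
  proof -
    have "a \<in> ?V - {u} \<and> b \<in> ?V - {u} \<and> ?B a b \<longleftrightarrow> a \<in> ?V - {u} \<and> b \<in> ?V - {u} \<and> A a b" for a b
      using assms(3) by (auto simp: contract_def irreflp_def)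
    then show ?thesis unfolding edge_set_def by presburger
  qed
  \<comment> \<open>The two neighbourhoods overlap in \<open>T\<close>, so \<open>card T\<close>
    pairs of edges merge; the edge \<open>u v\<close> itself is the additional one that
    disappears.\<close>
  moreover have "nbrs ?V ?B u = nbrs ?V A u \<union> (nbrs V A v - {u})"
    using uv by (auto simp: nbrs_def contract_def)
  moreover have "nbrs ?V A u \<inter> (nbrs V A v - {u}) = T"
    using uv by (auto simp: nbrs_def T_def)
  moreover have "card (nbrs V A v) = Suc (card (nbrs V A v - {u}))"
    using assms(1,4) vu by (intro card.remove) (auto simp: nbrs_def)
  ultimately have "card (edge_set V A) = card (edge_set ?V ?B) + card T + 1"
    using card_Un_Int[OF fin(2,3)] by simp
  moreover have "card V = Suc (card ?V)"
    using assms(1,5) by (rule card.remove)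
  ultimately show ?thesis using cyc by (simp add: beth_def)
qed

subsection \<open>Kempe chains\<close>

text \<open>
  Colouring the contraction of the edge \<open>s v\<close> amounts to colouring the graph without \<open>v\<close> so
  that no other neighbour of \<open>v\<close> shares the colour of \<open>s\<close>.
\<close>

lemma kempe_cycle:
  assumes "symp A" "irreflp A" "v \<in> V" "\<not> colorable V A k" "s \<in> nbrs V A v"
    and c: "\<forall>y\<in>V - {v}. c y < k"
      "\<forall>y\<in>V - {v}. \<forall>z\<in>V - {v}. contract A s v y z \<longrightarrow> c y \<noteq> c z"
    and j: "j < k" "j \<noteq> c s"
  shows "\<exists>W\<in>cycles V A. v \<in> W \<and> (\<exists>t\<in>nbrs V A v. c t = j \<and> W \<inter> nbrs V A v = {s, t})"
proof -
  have sym: "A a b \<Longrightarrow> A b a" for a b using assms(1) by (rule sympD)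
  have irr: "\<not> A a a" for a using assms(2) by (rule irreflpD)
  have s: "s \<in> V" "A v s" "s \<noteq> v" using assms(5) irr by (auto simp: nbrs_def)
  have proper: "c a \<noteq> c b" if "a \<in> V - {v}" "b \<in> V - {v}" "A a b" for a b
  proof -
    have "a \<noteq> b" using that(3) irr[of a] by blast
    then have "contract A s v a b" using that(3) by (simp add: contract_def)
    then show ?thesis using c(2) that by blast
  qed
  \<comment> \<open>In the contraction every other neighbour of \<open>v\<close> is adjacent to
    \<open>s\<close>.\<close>
  have uniq: "c b \<noteq> c s" if "b \<in> nbrs V A v" "b \<noteq> s" for b
  proof -
    have "b \<in> V - {v}" "contract A s v s b"
      using that irr by (auto simp: nbrs_def contract_def)
    then show ?thesis using c(2) s by force
  qed
  \<comment> \<open>\<open>R\<close> is the Kempe chain of \<open>s\<close>: its component in the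
    subgraph on the colours \<open>c s\<close> and \<open>j\<close>.\<close>
  define B where "B = {y \<in> V - {v}. c y = c s \<or> c y = j}"
  define r where "r = {(a, b). a \<in> B \<and> b \<in> B \<and> A a b}"
  define R where "R = {y. (s, y) \<in> r\<^sup>*}"
  have sB: "s \<in> B" using s by (simp add: B_def)
  have RB: "R \<subseteq> B"
  proof
    fix y assume "y \<in> R"
    then have "(s, y) \<in> r\<^sup>*" by (simp add: R_def)
    then show "y \<in> B" by (induction rule: rtrancl_induct) (auto simp: sB r_def)
  qed
  have sR: "s \<in> R" by (simp add: R_def)
  have closed: "b \<in> R" if "a \<in> R" "b \<in> B" "A a b" for a b
  proof -
    have "(a, b) \<in> r" using that RB by (auto simp: r_def)
    then show ?thesis using that(1) by (auto simp: R_def)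
  qed
  \<comment> \<open>Otherwise swap the two colours on \<open>R\<close>. No neighbour of
    \<open>v\<close> keeps or receives the colour \<open>c s\<close>, so \<open>v\<close> can take
    it, and the whole graph is \<open>k\<close>-coloured.\<close>
  have "\<exists>t\<in>R. t \<in> nbrs V A v \<and> c t = j"
  proof (rule ccontr)
    assume none: "\<not> (\<exists>t\<in>R. t \<in> nbrs V A v \<and> c t = j)"
    define c' where
      "c' y = (if y = v then c s else if y \<in> R then (if c y = j then c s else j) else c y)" for y
    have "\<forall>y\<in>V. c' y < k"
      using c(1) s j by (auto simp: c'_def)
    moreover have half: "c' v \<noteq> c' b" if "b \<in> V" "A v b" for b
    proof -
      have b: "b \<in> nbrs V A v" "b \<noteq> v" using that irr by (auto simp: nbrs_def)
      show ?thesis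
      proof (cases "b \<in> R")
        case True
        then show ?thesis using none b j by (auto simp: c'_def)
      next
        case False
        then have "c b \<noteq> c s" using uniq b sR by blast
        then show ?thesis using False b by (simp add: c'_def)
      qed
    qed
    have other: "c' a \<noteq> c' b" if ab: "a \<in> V - {v}" "b \<in> V - {v}" "A a b" for a b
    proof -
      have ne: "c a \<noteq> c b" using proper ab by blast
      \<comment> \<open>An edge leaving \<open>R\<close> ends outside \<open>B\<close>, at a colour
        that the swap does not involve.\<close>
      have out: "c' x \<noteq> c' y" if "x \<in> R" "y \<notin> R" "y \<in> V - {v}" "A x y" "x \<noteq> v" for x y
      proof -
        have "y \<notin> B" using closed that by blast
        then show ?thesis using that by (auto simp: c'_def B_def)
      qed
      have colR: "c x = c s \<or> c x = j" if "x \<in> R" for x using that RB by (auto simp: B_def)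
      consider "a \<in> R" "b \<in> R" | "a \<in> R" "b \<notin> R" | "a \<notin> R" "b \<in> R" | "a \<notin> R" "b \<notin> R" by blast
      then show ?thesis
      proof cases
        case 1
        then show ?thesis using ne ab colR[of a] colR[of b] j by (auto simp: c'_def)
      next
        case 2
        then show ?thesis using out ab by blast
      next
        case 3
        then show ?thesis using out[of b a] ab sym by (metis DiffE singletonI)
      next
        case 4
        then show ?thesis using ne ab by (auto simp: c'_def)
      qed
    qed
    have "\<forall>a\<in>V. \<forall>b\<in>V. A a b \<longrightarrow> c' a \<noteq> c' b"
    proof (intro ballI impI)
      fix a b assume ab: "a \<in> V" "b \<in> V" "A a b"
      show "c' a \<noteq> c' b"
      proof (cases "a = v")
        case True
        then show ?thesis using half ab by blast
      next
        case av: False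
        show ?thesis
        proof (cases "b = v")
          case True
          then show ?thesis using half[of a] ab sym by metis
        next
          case False
          then show ?thesis using other ab av by blast
        qed
      qed
    qed
    ultimately have "colorable V A k" unfolding colorable_def by blast
    then show False using assms(4) by blast
  qed
  then obtain t0 where t0: "(s, t0) \<in> r\<^sup>*" "t0 \<in> nbrs V A v" "c t0 = j" by (auto simp: R_def)
  \<comment> \<open>\<open>s\<close> is taken out of the target set because it is itself a neighbour
    of \<open>v\<close>. The path meets the remaining neighbours only at its end, so
    \<open>v\<close> closes it to an induced cycle.\<close>
  then have "t0 \<in> nbrs V A v - {s}" using j by auto
  from obtain_induced_path[OF t0(1)[unfolded r_def] sB this]
  obtain p where p: "p \<noteq> []" "induced_path A p" "hd p = s" "set p \<subseteq> B"
    "set p \<inter> (nbrs V A v - {s}) = {last p}" by blast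
  let ?t = "last p"
  have t: "?t \<in> nbrs V A v" "?t \<noteq> s" "?t \<in> B" using p(1,4,5) by auto
  have ct: "c ?t = j" using uniq[OF t(1,2)] t(3) by (auto simp: B_def)
  have sp: "s \<in> set p" using p(1,3) by auto
  have vp: "v \<notin> set p" using p(4) by (auto simp: B_def)
  have pV: "set p \<subseteq> V" using p(4) by (auto simp: B_def)
  have int: "set p \<inter> nbrs V A v = {s, ?t}" using p(5) sp assms(5) by blast
  moreover have "set p \<inter> nbrs V A v = {z \<in> set p. A v z}" using pV by (auto simp: nbrs_def)
  ultimately have "{z \<in> set p. A v z} = {hd p, last p}" using p(3) by simp
  moreover have "2 \<le> length p"
  proof (rule ccontr)
    assume "\<not> 2 \<le> length p"
    then have "hd p = last p" using p(1) by (cases p) (auto simp: Suc_le_eq)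
    then show False using t(2) p(3) by simp
  qed
  ultimately have "cycle_through A v p" using vp p(2) by (simp add: cycle_through_def)
  then have "cycle_set A (insert v (set p))" using cycle_set_iff[OF assms(1,2)] by blast
  then have "insert v (set p) \<in> cycles V A" using pV assms(3) by (auto simp: cycles_def)
  moreover have "insert v (set p) \<inter> nbrs V A v = {s, ?t}"
    using int irr by (auto simp: nbrs_def)
  ultimately show ?thesis using t(1) ct by blast
qed


subsection \<open>The lower bound\<close>

text \<open>Double counting of the pairs \<open>s \<in> h\<close>: every \<open>h\<close> occurs in
  exactly two of them.\<close>

lemma card_pairs_lower_bound:
  assumes "finite N" "finite H" "\<And>h. h \<in> H \<Longrightarrow> h \<subseteq> N \<and> card h = 2"
    and "\<And>s. s \<in> N \<Longrightarrow> m \<le> card {h \<in> H. s \<in> h}"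
  shows "card N * m \<le> 2 * card H"
proof -
  have "(\<Sum>s\<in>N. card {h \<in> H. s \<in> h}) = (\<Sum>h\<in>H. 2)"
  proof (rule sum_multicount_gen[OF assms(1,2)], rule ballI)
    fix h assume "h \<in> H"
    then have "{s \<in> N. s \<in> h} = h" "card h = 2" using assms(3) by auto
    then show "card {s \<in> N. s \<in> h} = 2" by simp
  qed
  moreover have "card N * m \<le> (\<Sum>s\<in>N. card {h \<in> H. s \<in> h})"
    using sum_mono[of N "\<lambda>_. m"] assms(4) by simp
  ultimately show ?thesis by simp
qed

text \<open>A cycle through \<open>v\<close> meets the neighbourhood of \<open>v\<close> in a pair.
  Kempe cycles give each neighbour \<open>s\<close> at least \<open>m\<close> such pairs, one for
  each colour other than that of \<open>s\<close>; double counting the pairs bounds the cycles, and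
  the partners of one \<open>s\<close> bound the degree.\<close>

lemma card_cycles_through_bound:
  assumes "finite V" "symp A" "irreflp A" "v \<in> V" "\<not> colorable V A (Suc m)"
    and col: "\<And>s. s \<in> nbrs V A v \<Longrightarrow> colorable (V - {v}) (contract A s v) (Suc m)"
    and ne: "nbrs V A v \<noteq> {}"
  shows "card (nbrs V A v) * m \<le> 2 * card {W \<in> cycles V A. v \<in> W} \<and> Suc m \<le> card (nbrs V A v)"
proof -
  let ?N = "nbrs V A v" and ?C = "{W \<in> cycles V A. v \<in> W}"
  \<comment> \<open>Several cycles may share a pair, so \<open>card H\<close> only bounds the number
    of cycles from below, which is the direction wanted.\<close>
  define H where "H = (\<lambda>W. W \<inter> ?N) ` ?C"
  have finN: "finite ?N" using assms(1) by (simp add: nbrs_def)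
  have finC: "finite ?C" using finite_cycles[OF assms(1)] by simp
  have H2: "h \<subseteq> ?N \<and> card h = 2" if hH: "h \<in> H" for h
  proof -
    obtain W where W: "W \<in> cycles V A" "v \<in> W" "h = W \<inter> ?N"
      using hH unfolding H_def by blast
    then have "cycle_set A W" "W \<subseteq> V" by (auto simp: cycles_def)
    then obtain p where p: "W = insert v (set p)" "cycle_through A v p"
      using cycle_set_iff[OF assms(2,3) W(2)] by blast
    have "h = {z \<in> set p. A v z}"
      using W(3) p(1) \<open>W \<subseteq> V\<close> irreflpD[OF assms(3), of v] by (auto simp: nbrs_def)
    then have h: "h = {hd p, last p}" using p(2) by (simp add: cycle_through_def)
    have "distinct p" "2 \<le> length p"
      using p(2) induced_path_distinct by (auto simp: cycle_through_def)
    moreover from this have "p \<noteq> []" by auto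
    ultimately have "hd p \<noteq> last p"
      by (simp add: hd_conv_nth last_conv_nth nth_eq_iff_index_eq)
    then have "card h = 2" using h by simp
    then show ?thesis using W(3) by blast
  qed
  have kempe: "m \<le> card {h \<in> H. s \<in> h} \<and> m \<le> card (?N - {s})" if s: "s \<in> ?N" for s
  proof -
    obtain c where c: "\<forall>y\<in>V - {v}. c y < Suc m"
      "\<forall>y\<in>V - {v}. \<forall>z\<in>V - {v}. contract A s v y z \<longrightarrow> c y \<noteq> c z"
      using col[OF s] unfolding colorable_def by blast
    let ?J = "{..<Suc m} - {c s}"
    have "s \<in> V - {v}" using s irreflpD[OF assms(3), of v] by (auto simp: nbrs_def)
    then have J: "card ?J = m" using c(1) by simp
    have "\<exists>t\<in>?N. c t = j \<and> {s, t} \<in> H" if "j \<in> ?J" for j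
    proof -
      obtain W t where Wt: "W \<in> cycles V A" "v \<in> W" "t \<in> ?N" "c t = j" "W \<inter> ?N = {s, t}"
        using kempe_cycle[OF assms(2-5) s c, of j] \<open>j \<in> ?J\<close> by auto
      then have "{s, t} \<in> H" unfolding H_def by (intro image_eqI[of _ _ W]) auto
      then show ?thesis using Wt by blast
    qed
    then obtain t where t: "\<And>j. j \<in> ?J \<Longrightarrow> t j \<in> ?N \<and> c (t j) = j \<and> {s, t j} \<in> H"
      by metis
    \<comment> \<open>The colour of \<open>t j\<close> is \<open>j\<close>, so different colours
      give different partners.\<close>
    have "inj_on t ?J" using t by (metis inj_on_def)
    moreover have "t ` ?J \<subseteq> ?N - {s}"
    proof (rule image_subsetI)
      fix j assume "j \<in> ?J"
      then have "t j \<in> ?N" "c (t j) \<noteq> c s" using t[of j] by auto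
      then show "t j \<in> ?N - {s}" by auto
    qed
    ultimately have "m \<le> card (?N - {s})"
      using card_inj_on_le[of t ?J "?N - {s}"] finN J by simp
    moreover have "inj_on (\<lambda>j. {s, t j}) ?J"
    proof (rule inj_onI)
      fix i j assume ij: "i \<in> ?J" "j \<in> ?J" "{s, t i} = {s, t j}"
      then have "t i = t j" by (auto simp: doubleton_eq_iff)
      then show "i = j" using t ij by metis
    qed
    moreover have "(\<lambda>j. {s, t j}) ` ?J \<subseteq> {h \<in> H. s \<in> h}" using t by auto
    moreover have "finite {h \<in> H. s \<in> h}" using finC by (simp add: H_def)
    ultimately show ?thesis
      using card_inj_on_le[of "\<lambda>j. {s, t j}" ?J "{h \<in> H. s \<in> h}"] J by simp
  qed
  have "card ?N * m \<le> 2 * card H"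
    using finN finC H2 kempe by (intro card_pairs_lower_bound) (auto simp: H_def)
  moreover have "card H \<le> card ?C" unfolding H_def by (rule card_image_le[OF finC])
  moreover obtain s where "s \<in> ?N" using ne by blast
  then have "Suc m \<le> card ?N" using kempe[of s] card.remove[OF finN, of s] by linarith
  ultimately show ?thesis by linarith
qed

text \<open>The vertex \<open>v\<close> takes the fresh colour \<open>k\<close>. In the induction
  this shows that deleting a vertex lowers the number of excluded colours by at most one.\<close>

lemma colorable_remove:
  assumes "colorable (V - {v}) A k" "irreflp A"
  shows "colorable V A (Suc k)"
proof -
  obtain c where c: "\<forall>y\<in>V - {v}. c y < k"
      "\<forall>y\<in>V - {v}. \<forall>z\<in>V - {v}. A y z \<longrightarrow> c y \<noteq> c z"
    using assms(1) unfolding colorable_def by blast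
  have "\<not> A v v" using assms(2) by (rule irreflpD)
  moreover have "c y < Suc k \<and> c y \<noteq> k" if "y \<in> V - {v}" for y
    using c(1) that by (auto simp: less_Suc_eq dest: bspec)
  ultimately show ?thesis
    using c(2) unfolding colorable_def by (intro exI[of _ "c(v := k)"]) auto
qed

text \<open>Speaking of graphs that are not \<open>k\<close>-colourable, rather than of an exact
  chromatic number, lets the induction pass to deletions and contractions directly.\<close>

theorem not_colorable_beth_ge:
  assumes "finite V" "symp A" "irreflp A" "\<not> colorable V A k"
  shows "int (k choose 3) + 1 \<le> beth V A"
  using assms
proof (induction "card V" arbitrary: V A k rule: less_induct)
  case less
  note fin = less.prems(1) and sym = less.prems(2) and irr = less.prems(3)
  have smaller: "card (V - {v}) < card V" if "v \<in> V" for v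
    using fin that by (rule card_Diff1_less)
  have contracted: "int (k' choose 3) + 1 \<le> beth V A"
    if "u \<in> V" "v \<in> V" "A u v" "\<not> colorable (V - {v}) (contract A u v) k'" for u v k'
  proof -
    have "int (k' choose 3) + 1 \<le> beth (V - {v}) (contract A u v)"
      using less.hyps[OF smaller[OF that(2)] _ symp_contract[OF sym] irreflp_contract that(4)] fin
      by simp
    then show ?thesis using beth_contract[OF fin sym irr that(1-3)] by linarith
  qed
  show ?case
  proof (cases "\<exists>u\<in>V. \<exists>v\<in>V. A u v")
    case False
    \<comment> \<open>Without edges one colour suffices, so \<open>k = 0\<close>, and a single
      vertex already gives the bound.\<close>
    then have "edge_set V A = {}" by (auto simp: edge_set_def)
    moreover have "colorable V A 1"
      using False by (auto simp: colorable_def intro: exI[of _ "\<lambda>_. 0"])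
    then have "k = 0"
      using less.prems(4) unfolding colorable_def by (metis One_nat_def less_Suc0 not_gr_zero)
    moreover have "V \<noteq> {}" using less.prems(4) by (auto simp: colorable_def)
    then have "1 \<le> card V" using fin by (simp add: Suc_leI card_gt_0_iff)
    ultimately show ?thesis by (simp add: beth_def binomial_eq_0)
  next
    case True
    then obtain u v where uv: "u \<in> V" "v \<in> V" "A u v" by blast
    show ?thesis
    proof (cases "k < 3")
      case True
      \<comment> \<open>For \<open>k < 3\<close> the claim is \<open>1 \<le> beth V A\<close>, the
        same as for 0 colours, and no nonempty graph is 0-colourable.\<close>
      have "u \<in> V - {v}" using uv irreflpD[OF irr, of v] by auto
      then have "\<not> colorable (V - {v}) (contract A u v) 0" by (auto simp: colorable_def)
      from contracted[OF uv this] show ?thesis using True by (simp add: binomial_eq_0)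
    next
      case False
      define m where "m = k - 1"
      have k: "k = Suc m" "2 \<le> m" using False by (auto simp: m_def)
      show ?thesis
      proof (cases "\<exists>s\<in>nbrs V A v. \<not> colorable (V - {v}) (contract A s v) k")
        case True
        then obtain s where "s \<in> V" "A s v" "\<not> colorable (V - {v}) (contract A s v) k"
          using sym by (auto simp: nbrs_def dest: sympD)
        then show ?thesis using contracted uv(2) by blast
      next
        case False
        define d where "d = card (nbrs V A v)"
        define x where "x = card {W \<in> cycles V A. v \<in> W}"
        have "nbrs V A v \<noteq> {}" using uv sym by (auto simp: nbrs_def dest: sympD)
        then have dx: "d * m \<le> 2 * x" "Suc m \<le> d"
          using card_cycles_through_bound[OF fin sym irr uv(2), of m] less.prems(4) False k
          by (auto simp: d_def x_def)
        have "\<not> colorable (V - {v}) A m"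
          using colorable_remove[OF _ irr] less.prems(4) k by blast
        then have IH: "int (m choose 3) + 1 \<le> beth (V - {v}) A"
          using less.hyps[OF smaller[OF uv(2)] _ sym irr] fin by simp
        \<comment> \<open>The contribution \<open>x - d + 1\<close> of \<open>v\<close> has to pay
          for the drop from \<open>k\<close> to \<open>m\<close> colours. Twice it is at least
          \<open>d * (m - 2) + 2\<close>, hence at least
          \<open>(m + 1) * (m - 2) + 2 = m * (m - 1)\<close>; the first factor may be lowered
          because \<open>m \<ge> 2\<close>.\<close>
        have "int (m choose 2) + int d \<le> int x + 1"
        proof -
          have "even (m * (m - 1))" by (cases m) auto
          then have "2 * (m choose 2) = m * (m - 1)" by (simp add: choose_two)
          then have "int (2 * (m choose 2)) = int (m * (m - 1))" by (simp only:)
          then have "2 * int (m choose 2) = int m * (int m - 1)"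
            using k(2) by (simp add: of_nat_diff)
          moreover have "(int m + 1) * (int m - 2) \<le> int d * (int m - 2)"
            using dx(2) k(2) by (intro mult_right_mono) auto
          moreover have "int d * int m \<le> 2 * int x" using dx(1) by (simp flip: of_nat_mult)
          ultimately show ?thesis by (simp add: algebra_simps)
        qed
        moreover have "int (k choose 3) = int (m choose 3) + int (m choose 2)"
          using k by (simp add: numeral_3_eq_3 numeral_2_eq_2)
        moreover have "beth V A = beth (V - {v}) A + int x - int d + 1"
          using beth_remove[OF fin sym irr uv(2)] by (simp add: d_def x_def)
        ultimately show ?thesis using IH by linarith
      qed
    qed
  qed
qed

subsection \<open>Graphs as pairs\<close>

context
  fixes G :: "'a graph" and A
  assumes fsg: "finite_simple_graph G"
  defines "A \<equiv> \<lambda>a b. {a, b} \<in> edges G"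
begin

lemma symp_adj: "symp A"
  by (simp add: symp_def A_def insert_commute)

lemma irreflp_adj: "irreflp A"
  using fsg by (auto simp: irreflp_def A_def finite_simple_graph_def)

lemma edges_eq: "edges G = edge_set (vertices G) A"
proof (intro equalityI subsetI)
  fix e assume "e \<in> edges G"
  moreover from this have "e \<subseteq> vertices G" "card e = 2"
    using fsg by (auto simp: finite_simple_graph_def)
  ultimately show "e \<in> edge_set (vertices G) A"
    by (auto simp: card_2_iff edge_set_def A_def)
qed (auto simp: edge_set_def A_def)

text \<open>One side compares edge sets, the other adjacency of indices. Every edge on either side
  joins two listed vertices, and distinctness recovers the indices from the pair.\<close>

lemma is_cycle_iff: "is_cycle (induced_subgraph G W) \<longleftrightarrow> cycle_set A W"
proof -
  have key: "edges (induced_subgraph G W) = {{vs ! i, vs ! (Suc i mod length vs)} | i. i < length vs}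
      \<longleftrightarrow> cyclic_list A vs" (is "_ = ?E \<longleftrightarrow> _")
    if vs: "distinct vs" "3 \<le> length vs" "W = set vs" for vs
  proof -
    let ?n = "length vs"
    have mem: "{vs ! i, vs ! j} \<in> ?E \<longleftrightarrow> j = Suc i mod ?n \<or> i = Suc j mod ?n"
      if ij: "i < ?n" "j < ?n" for i j
    proof -
      have "{vs ! i, vs ! j} = {vs ! l, vs ! (Suc l mod ?n)} \<longleftrightarrow>
          i = l \<and> j = Suc l mod ?n \<or> i = Suc l mod ?n \<and> j = l" if "l < ?n" for l
      proof -
        have "Suc l mod ?n < ?n" using that by (intro mod_less_divisor) linarith
        then show ?thesis
          using ij that vs(1) by (simp add: doubleton_eq_iff nth_eq_iff_index_eq)
      qed
      then show ?thesis using ij by auto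
    qed
    have pairs: "\<exists>i<?n. \<exists>j<?n. e = {vs ! i, vs ! j}"
      if "e \<in> edges (induced_subgraph G W) \<or> e \<in> ?E" for e
    proof (cases "e \<in> ?E")
      case True
      then obtain i where "i < ?n" "e = {vs ! i, vs ! (Suc i mod ?n)}" by blast
      moreover from this have "Suc i mod ?n < ?n" by (intro mod_less_divisor) linarith
      ultimately show ?thesis by blast
    next
      case False
      then have "e \<in> edges G" "e \<subseteq> set vs" using that vs(3) by (auto simp: induced_subgraph_def)
      then obtain a b where "e = {a, b}" "a \<in> set vs" "b \<in> set vs"
        using fsg by (auto simp: finite_simple_graph_def card_2_iff)
      then show ?thesis by (metis in_set_conv_nth)
    qed
    have sub: "{vs ! i, vs ! j} \<in> edges (induced_subgraph G W) \<longleftrightarrow> A (vs ! i) (vs ! j)"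
      if "i < ?n" "j < ?n" for i j
      using that vs(3) by (auto simp: induced_subgraph_def A_def)
    show ?thesis
    proof
      assume "edges (induced_subgraph G W) = ?E"
      then show "cyclic_list A vs"
        using vs mem sub unfolding cyclic_list_def by auto
    next
      assume "cyclic_list A vs"
      then have "{vs ! i, vs ! j} \<in> edges (induced_subgraph G W) \<longleftrightarrow> {vs ! i, vs ! j} \<in> ?E"
        if "i < ?n" "j < ?n" for i j
        using mem[OF that] sub[OF that] that unfolding cyclic_list_def by blast
      then show "edges (induced_subgraph G W) = ?E"
        using pairs by (metis (no_types, lifting) subsetI subset_antisym)
    qed
  qed
  have verts: "vertices (induced_subgraph G W) = W" by (simp add: induced_subgraph_def)
  show ?thesis
  proof
    assume "is_cycle (induced_subgraph G W)"
    then obtain vs where vs: "distinct vs" "3 \<le> length vs" "W = set vs"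
      "edges (induced_subgraph G W) = {{vs ! i, vs ! (Suc i mod length vs)} | i. i < length vs}"
      unfolding is_cycle_def verts by blast
    then have "cyclic_list A vs" using key[OF vs(1-3)] by blast
    then show "cycle_set A W" using vs(3) unfolding cycle_set_def by blast
  next
    assume "cycle_set A W"
    then obtain vs where vs: "W = set vs" "cyclic_list A vs" by (auto simp: cycle_set_def)
    then have len: "distinct vs" "3 \<le> length vs" by (auto simp: cyclic_list_def)
    then show "is_cycle (induced_subgraph G W)"
      using key[OF len vs(1)] vs unfolding is_cycle_def verts by blast
  qed
qed

text \<open>An induced subgraph and its vertex set determine each other, so both ways of counting
  cycles agree.\<close>

lemma beth2_eq: "beth2 G = beth (vertices G) A"
proof -
  have "induced_cycles G = induced_subgraph G ` cycles (vertices G) A"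
    using is_cycle_iff by (auto simp: induced_cycles_def cycles_def)
  moreover have "inj (induced_subgraph G)"
    by (auto simp: inj_def induced_subgraph_def)
  ultimately have "card (induced_cycles G) = card (cycles (vertices G) A)"
    by (metis card_image inj_on_subset subset_UNIV)
  then show ?thesis using edges_eq by (simp add: beth2_def beth_def)
qed

lemma colorable_iff_proper_coloring:
  "colorable (vertices G) A k \<longleftrightarrow> (\<exists>c. proper_coloring G k c)"
proof -
  have "u \<in> vertices G \<and> v \<in> vertices G" if "{u, v} \<in> edges G" for u v
    using fsg that by (auto simp: finite_simple_graph_def)
  then show ?thesis unfolding colorable_def proper_coloring_def A_def by meson
qed

text \<open>For a positive chromatic number \<open>Suc k\<close>, Pascal's rule turns the left side
  into \<open>(k choose 3) + 1\<close>, and minimality excludes \<open>k\<close> colours.\<close>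

lemma beth2_ge_choose:
  "int (chromatic_number G choose 3) - int (chromatic_number G choose 2)
     + int (chromatic_number G choose 1) \<le> beth2 G"
proof (cases "chromatic_number G")
  case 0
  \<comment> \<open>The value of \<open>LEAST\<close> is attained only once some colouring exists;
    an injection into the naturals is one. Chromatic number 0 then means the empty graph.\<close>
  have "finite (vertices G)" using fsg by (simp add: finite_simple_graph_def)
  then obtain f :: "'a \<Rightarrow> nat" and n where f: "f ` vertices G = {i. i < n}" "inj_on f (vertices G)"
    using finite_imp_inj_to_nat_seg by blast
  have "colorable (vertices G) A n"
    using f irreflp_adj unfolding colorable_def
    by (intro exI[of _ f]) (auto simp: inj_on_def irreflp_def)
  then have "\<exists>c. proper_coloring G n c" using colorable_iff_proper_coloring by blast
  then have "\<exists>c. proper_coloring G (chromatic_number G) c"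
    unfolding chromatic_number_def by (rule LeastI)
  then have "vertices G = {}" using 0 by (auto simp: proper_coloring_def)
  then have "beth2 G = int (card (cycles {} A))"
    using beth2_eq by (simp add: beth_def edge_set_def)
  then show ?thesis using 0 by (simp add: binomial_eq_0)
next
  case (Suc k)
  have "\<not> (\<exists>c. proper_coloring G k c)"
    using Suc unfolding chromatic_number_def by (intro not_less_Least) simp
  then have "int (k choose 3) + 1 \<le> beth2 G"
    using not_colorable_beth_ge[OF _ symp_adj irreflp_adj] colorable_iff_proper_coloring beth2_eq fsg
    by (simp add: finite_simple_graph_def)
  then show ?thesis using Suc by (simp add: numeral_3_eq_3 numeral_2_eq_2)
qed

end

section \<open>The second characteristic of complete graphs, and the conclusion\<close>

lemma beth2_complete_graph:
  "beth2 (complete_graph t) = int (t choose 3) - int (t choose 2) + int (t choose 1)"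
proof -
  define A where "A = (\<lambda>a b. {a, b} \<in> edges (complete_graph t))"
  have fsg: "finite_simple_graph (complete_graph t)"
    by (simp add: finite_simple_graph_def complete_graph_def)
  have verts: "vertices (complete_graph t) = {..<t}" by (simp add: complete_graph_def)
  have A: "A a b \<longleftrightarrow> a < t \<and> b < t \<and> a \<noteq> b" for a b
    by (auto simp: A_def complete_graph_def card_insert_if)
  have sym: "symp A" and irr: "irreflp A" by (auto simp: symp_def irreflp_def A)
  \<comment> \<open>The first and third vertex of an induced cycle of length at least 4 are not
    adjacent, which is impossible here; so the induced cycles are the triangles.\<close>
  have "cycles {..<t} A = {W. W \<subseteq> {..<t} \<and> card W = 3}"
  proof (intro equalityI subsetI)
    fix W assume W: "W \<in> cycles {..<t} A"
    then obtain vs where vs: "set vs = W" "cyclic_list A vs" and Wt: "W \<subseteq> {..<t}"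
      by (auto simp: cycles_def cycle_set_def)
    have len: "distinct vs" "3 \<le> length vs" using vs(2) by (auto simp: cyclic_list_def)
    have "length vs = 3"
    proof (rule ccontr)
      assume "length vs \<noteq> 3"
      then have l4: "4 \<le> length vs" using len by simp
      then have pos: "0 < length vs" "2 < length vs" by linarith+
      then have "A (vs ! 0) (vs ! 2) \<longleftrightarrow> 2 = Suc 0 mod length vs \<or> 0 = Suc 2 mod length vs"
        using vs(2) unfolding cyclic_list_def by blast
      then have "\<not> A (vs ! 0) (vs ! 2)" using l4 by simp
      moreover have "vs ! 0 \<in> W" "vs ! 2 \<in> W"
        using vs(1) pos[THEN nth_mem] by blast+
      moreover have "vs ! 0 \<noteq> vs ! 2" using nth_eq_iff_index_eq[OF len(1) pos] by simp
      ultimately show False using Wt by (auto simp: A)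
    qed
    then show "W \<in> {W. W \<subseteq> {..<t} \<and> card W = 3}"
      using vs(1) Wt distinct_card[OF len(1)] by simp
  next
    fix W assume "W \<in> {W. W \<subseteq> {..<t} \<and> card W = 3}"
    then obtain a b c where "W = {a, b, c}" "a \<noteq> b" "a \<noteq> c" "b \<noteq> c" "W \<subseteq> {..<t}"
      by (auto simp: card_3_iff)
    then show "W \<in> cycles {..<t} A"
      using cycle_set_triangle[OF sym irr, of a b c] by (auto simp: cycles_def A)
  qed
  moreover have "card {W. W \<subseteq> {..<t} \<and> card W = 3} = t choose 3"
    using n_subsets[of "{..<t}" 3] by simp
  moreover have "card (edges (complete_graph t)) = t choose 2"
    using n_subsets[of "{..<t}" 2] by (simp add: complete_graph_def)
  moreover have "edges (complete_graph t) = edge_set {..<t} A"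
    by (rule edges_eq[OF fsg, folded A_def, unfolded verts])
  ultimately show ?thesis
    using beth2_eq[OF fsg, folded A_def, unfolded verts] by (simp add: beth_def)
qed

theorem corollary3p2p1:
  fixes G :: "'a graph"
  assumes "finite_simple_graph G"
    and "connected_graph G"
  shows "beth2 (complete_graph (chromatic_number G)) \<le> beth2 G \<and>
    int (chromatic_number G choose 3) - int (chromatic_number G choose 2)
      + int (chromatic_number G choose 1) \<le> beth2 G"
  using beth2_ge_choose[OF assms(1)] beth2_complete_graph by simp

end
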